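(* Let $(J_3,\circ)$ be the Jordan algebra over $\mathbb{C}$ with basis $\{e_1,e_2\}$ and $e_1\circ e_1=2e_1$, $e_1\circ e_2=e_2\circ e_1=0$, $e_2\circ e_2=0$. Any Rota-Baxter operator on $(J_3,\circ)$ is of the form $\begin{pmatrix} 0&0\\ r_{21}&r_{22}\end{pmatrix}$ with $r_{21},r_{22}\in\mathbb{C}$. The induced pre-Jordan algebra is isomorphic to the $2$-dimensional pre-Jordan algebra with zero multiplication.
   Context: A Rota-Baxter operator (of weight $0$) on a Jordan algebra $(J,\circ)$ is a linear map $R:J\to J$ with $R(x)\circ R(y)=R(R(x)\circ y+x\circ R(y))$ for all $x,y\in J$. The matrix $(r_{ij})$ of $R$ in a basis $\{e_i\}$ is defined by $R(e_i)=\sum_j r_{ji}e_j$. The pre-Jordan algebra induced by $R$ is $J$ with the multiplication $x\cdot y:=R(x)\circ y$. *)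

theory Defs
  imports "HOL-Analysis.Analysis"
begin

locale algebra_over = vector_space smul
  for smul :: "'k::field \<Rightarrow> 'a::ab_group_add \<Rightarrow> 'a" +
  fixes prd :: "'a \<Rightarrow> 'a \<Rightarrow> 'a"
  assumes linear_right: "Vector_Spaces.linear smul smul (\<lambda>y. prd x y)"
    and linear_left: "Vector_Spaces.linear smul smul (\<lambda>x. prd x y)"

locale jordan_algebra = algebra_over +
  assumes mult_commute: "prd x y = prd y x"
    and jordan_identity: "prd (prd (prd x x) y) x = prd (prd x x) (prd y x)"

text \<open>
  Pre-Jordan algebras (Hou, Ni, Bai). The identities say that the left multiplications form a
  representation of the Jordan product \<open>x \<circ> y = x \<cdot> y + y \<cdot> x\<close>, which carries no factor \<open>1/2\<close>.
\<close>

definition circ_of :: "('a::ab_group_add \<Rightarrow> 'a \<Rightarrow> 'a) \<Rightarrow> 'a \<Rightarrow> 'a \<Rightarrow> 'a" where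
  "circ_of prd x y = prd x y + prd y x"

locale pre_jordan_algebra = algebra_over +
  assumes pre_jordan_1:
    "prd (circ_of prd x y) (prd z u) + prd (circ_of prd y z) (prd x u)
       + prd (circ_of prd z x) (prd y u)
     = prd z (prd (circ_of prd x y) u) + prd x (prd (circ_of prd y z) u)
       + prd y (prd (circ_of prd z x) u)"
    and pre_jordan_2:
    "prd x (prd y (prd z u)) + prd z (prd y (prd x u))
       + prd (circ_of prd (circ_of prd x z) y) u
     = prd z (prd (circ_of prd x y) u) + prd x (prd (circ_of prd y z) u)
       + prd y (prd (circ_of prd z x) u)"

definition rota_baxter_operator ::
  "('k::field \<Rightarrow> 'a::ab_group_add \<Rightarrow> 'a) \<Rightarrow> ('a \<Rightarrow> 'a \<Rightarrow> 'a) \<Rightarrow> ('a \<Rightarrow> 'a) \<Rightarrow> bool" where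
  "rota_baxter_operator smul prd R \<longleftrightarrow>
     Vector_Spaces.linear smul smul R \<and>
     (\<forall>x y. prd (R x) (R y) = R (prd (R x) y + prd x (R y)))"

definition induced_mult :: "('a \<Rightarrow> 'a \<Rightarrow> 'a) \<Rightarrow> ('a \<Rightarrow> 'a) \<Rightarrow> 'a \<Rightarrow> 'a \<Rightarrow> 'a" where
  "induced_mult prd R x y = prd (R x) y"

definition pre_jordan_isomorphic ::
  "('k::field \<Rightarrow> 'a::ab_group_add \<Rightarrow> 'a) \<Rightarrow> ('a \<Rightarrow> 'a \<Rightarrow> 'a) \<Rightarrow>
   ('k \<Rightarrow> 'b::ab_group_add \<Rightarrow> 'b) \<Rightarrow> ('b \<Rightarrow> 'b \<Rightarrow> 'b) \<Rightarrow> bool" where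
  "pre_jordan_isomorphic smul prd smul' prd' \<longleftrightarrow>
     pre_jordan_algebra smul prd \<and> pre_jordan_algebra smul' prd' \<and>
     (\<exists>f. Vector_Spaces.linear smul smul' f \<and> bij f \<and>
          (\<forall>x y. f (prd x y) = prd' (f x) (f y)))"

definition is_basis :: "('k::field \<Rightarrow> 'a::ab_group_add \<Rightarrow> 'a) \<Rightarrow> ('n \<Rightarrow> 'a) \<Rightarrow> bool" where
  "is_basis smul e \<longleftrightarrow>
     inj e \<and> \<not> module.dependent smul (range e) \<and> module.span smul (range e) = UNIV"

text \<open>Column \<open>i\<close> of the matrix holds the coordinates of \<open>R (e i)\<close>.\<close>

definition has_matrix ::
  "('k::field \<Rightarrow> 'a::ab_group_add \<Rightarrow> 'a) \<Rightarrow> ('n::finite \<Rightarrow> 'a) \<Rightarrow> ('a \<Rightarrow> 'a) \<Rightarrow> 'k^'n^'n \<Rightarrow> bool"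
  where
  "has_matrix smul e R r \<longleftrightarrow> (\<forall>i. R (e i) = (\<Sum>j\<in>UNIV. smul (r $ j $ i) (e j)))"

locale J3_algebra = jordan_algebra smul prd
  for smul :: "complex \<Rightarrow> 'a::ab_group_add \<Rightarrow> 'a" and prd :: "'a \<Rightarrow> 'a \<Rightarrow> 'a" +
  fixes e :: "2 \<Rightarrow> 'a"
  assumes basis: "is_basis smul e"
    and mult_11: "prd (e 1) (e 1) = smul 2 (e 1)"
    and mult_12: "prd (e 1) (e 2) = 0"
    and mult_21: "prd (e 2) (e 1) = 0"
    and mult_22: "prd (e 2) (e 2) = 0"

text \<open>The locale is inhabited.\<close>

lemma J3_algebra_model:
  "J3_algebra (*s) (\<lambda>x y. vector [2 * x$1 * y$1, 0] :: complex^2) (\<lambda>i. axis i 1)"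
proof
  have r: "range (\<lambda>i. axis i 1) = (cart_basis :: (complex^2) set)"
    by (auto simp: cart_basis_def)
  have "inj (\<lambda>i::2. axis i (1::complex))"
    by (auto simp: inj_on_def axis_eq_axis)
  then show "is_basis (*s) (\<lambda>i. axis i 1 :: complex^2)"
    unfolding is_basis_def r
    by (simp add: independent_cart_basis span_cart_basis)
qed (auto simp: vec_eq_iff forall_2 axis_def algebra_simps)

end

theory Submission
  imports Defs
begin

text \<open>
  Write \<open>\<phi>\<close> for the first coordinate with respect to \<open>e\<close>. The whole product of the algebra is
  \<open>x \<circ> y = 2 \<phi>(x) \<phi>(y) e\<^sub>1\<close> (\<open>prd_eq_fst_coord\<close>), so the Rota-Baxter identity reads
  \<open>2 \<phi>(R x) \<phi>(R y) e\<^sub>1 = 2 (\<phi>(R x) \<phi>(y) + \<phi>(x) \<phi>(R y)) R(e\<^sub>1)\<close>.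

  Both sides vanish if \<open>\<phi> \<circ> R = 0\<close>. Conversely, applying \<open>\<phi>\<close> to the identity at \<open>x = y = e\<^sub>1\<close>
  gives \<open>2 a\<^sup>2 = 4 a\<^sup>2\<close> for \<open>a = \<phi>(R e\<^sub>1)\<close>, hence \<open>a = 0\<close>, and at \<open>x = y = e\<^sub>2\<close> the right-hand side
  is zero, hence \<open>\<phi>(R e\<^sub>2) = 0\<close>. So the Rota-Baxter operators are exactly the linear maps with
  \<open>\<phi> \<circ> R = 0\<close> (\<open>rota_baxter_iff_fst_coord_zero\<close>), that is, those whose matrix has first row
  zero (\<open>has_matrix_iff_fst_coord_zero\<close>).

  For such an \<open>R\<close> the induced product \<open>R(x) \<circ> y\<close> is \<open>2 \<phi>(R x) \<phi>(y) e\<^sub>1 = 0\<close>, and then every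
  linear isomorphism onto the coordinate space respects the products; the coordinate map
  itself is one.
\<close>

definition coords ::
  "('k::field \<Rightarrow> 'a::ab_group_add \<Rightarrow> 'a) \<Rightarrow> ('n::finite \<Rightarrow> 'a) \<Rightarrow> 'a \<Rightarrow> 'k^'n" where
  "coords smul e x = (\<chi> i. module.representation smul (range e) x (e i))"

context vector_space
begin

lemma sum_coords:
  assumes "is_basis scale e"
  shows "(\<Sum>i\<in>UNIV. scale (coords scale e x $ i) (e i)) = x"
proof -
  have e: "inj e" "independent (range e)" "span (range e) = UNIV"
    using assms by (auto simp: is_basis_def)
  have "(\<Sum>b\<in>range e. scale (representation (range e) x b) b) = x"
    using e by (intro sum_representation_eq) auto
  then show ?thesis
    by (simp add: sum.reindex[OF e(1)] coords_def)
qed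

lemma linear_coords:
  assumes "is_basis scale e"
  shows "Vector_Spaces.linear scale vector_scalar_mult (coords scale e)"
proof -
  have e: "independent (range e)" "span (range e) = UNIV"
    using assms by (auto simp: is_basis_def)
  show ?thesis
    unfolding Vector_Spaces.linear_iff
    by (auto simp: vec_eq_iff coords_def representation_add[OF e(1)]
        representation_scale[OF e(1)] e(2) vector_space_axioms vec.vector_space_axioms)
qed

lemma coords_basis:
  assumes "is_basis scale e"
  shows "coords scale e (e i) = axis i 1"
proof -
  have e: "inj e" "independent (range e)"
    using assms by (auto simp: is_basis_def)
  show ?thesis
    using e(1) by (auto simp: vec_eq_iff coords_def representation_basis[OF e(2)] axis_def inj_eq)
qed

lemma coords_sum:
  assumes "is_basis scale e"
  shows "coords scale e (\<Sum>i\<in>UNIV. scale (v $ i) (e i)) = v"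
proof -
  interpret c: Vector_Spaces.linear scale "vector_scalar_mult" "coords scale e"
    by (rule linear_coords[OF assms])
  show ?thesis
    by (simp add: c.sum c.scale coords_basis[OF assms] basis_expansion)
qed

lemma bij_coords:
  assumes "is_basis scale e"
  shows "bij (coords scale e)"
  by (rule bij_betw_byWitness[where f' = "\<lambda>v. \<Sum>i\<in>UNIV. scale (v $ i) (e i)"])
     (auto simp: coords_sum[OF assms] sum_coords[OF assms])

lemma zero_mult_pre_jordan: "pre_jordan_algebra scale (\<lambda>x y. 0)"
  by unfold_locales (auto simp: circ_of_def)

end

context J3_algebra
begin

abbreviation fst_coord :: "'a \<Rightarrow> complex" where
  "fst_coord x \<equiv> coords smul e x $ 1"

lemma fst_coord_simps [simp]:
  "fst_coord (x + y) = fst_coord x + fst_coord y"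
  "fst_coord (smul c x) = c * fst_coord x"
  "fst_coord 0 = 0"
  "fst_coord (e 1) = 1"
  "fst_coord (e 2) = 0"
proof -
  interpret c: Vector_Spaces.linear smul "(*s)" "coords smul e"
    by (rule linear_coords[OF basis])
  show "fst_coord (x + y) = fst_coord x + fst_coord y"
    "fst_coord (smul c x) = c * fst_coord x"
    "fst_coord 0 = 0"
    by (simp_all add: c.add c.scale c.zero)
  show "fst_coord (e 1) = 1" "fst_coord (e 2) = 0"
    by (simp_all add: coords_basis[OF basis] axis_def)
qed

lemma sum_two_coords:
  "smul (coords smul e x $ 1) (e 1) + smul (coords smul e x $ 2) (e 2) = x"
  using sum_coords[OF basis, of x] by (simp add: sum_2)

text \<open>
  By bilinearity only the product \<open>e\<^sub>1 \<circ> e\<^sub>1\<close> contributes. Through this formula every product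
  below reduces to scalars.
\<close>

lemma prd_eq_fst_coord: "prd x y = smul (2 * fst_coord x * fst_coord y) (e 1)"
proof -
  interpret l: Vector_Spaces.linear smul smul "\<lambda>v. prd v w" for w by (rule linear_left)
  interpret r: Vector_Spaces.linear smul smul "\<lambda>w. prd v w" for v by (rule linear_right)
  have "prd (smul a (e 1) + smul b (e 2)) (smul a' (e 1) + smul b' (e 2)) = smul (2 * a * a') (e 1)"
    for a b a' b'
    by (simp add: l.add r.add l.scale r.scale mult_11 mult_12 mult_21 mult_22 mult_ac)
  from this[of "coords smul e x $ 1" "coords smul e x $ 2"
      "coords smul e y $ 1" "coords smul e y $ 2"]
  show ?thesis by (simp only: sum_two_coords)
qed

lemma fst_coord_comp_zero_iff:
  assumes "Vector_Spaces.linear smul smul R"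
  shows "(\<forall>x. fst_coord (R x) = 0) \<longleftrightarrow> fst_coord (R (e 1)) = 0 \<and> fst_coord (R (e 2)) = 0"
proof -
  interpret R: Vector_Spaces.linear smul smul R by (rule assms)
  have "fst_coord (R x) = coords smul e x $ 1 * fst_coord (R (e 1))
          + coords smul e x $ 2 * fst_coord (R (e 2))" for x
    by (subst sum_two_coords[of x, symmetric]) (simp only: R.add R.scale fst_coord_simps)
  then show ?thesis by (metis mult_zero_right add_0)
qed

text \<open>
  The first coordinate of the Rota-Baxter identity already forces \<open>\<phi>(R e\<^sub>1) = \<phi>(R e\<^sub>2) = 0\<close>, and
  once \<open>\<phi> \<circ> R = 0\<close> every product with a factor in the range of \<open>R\<close> vanishes, so that the identity
  holds trivially.
\<close>

lemma rota_baxter_iff_fst_coord_zero: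
  "rota_baxter_operator smul prd R \<longleftrightarrow>
     Vector_Spaces.linear smul smul R \<and> (\<forall>x. fst_coord (R x) = 0)"
proof
  assume "rota_baxter_operator smul prd R"
  then have lin: "Vector_Spaces.linear smul smul R"
    and rb: "prd (R x) (R y) = R (prd (R x) y + prd x (R y))" for x y
    by (auto simp: rota_baxter_operator_def)
  interpret R: Vector_Spaces.linear smul smul R by (rule lin)
  have *: "2 * fst_coord (R x) * fst_coord (R y)
      = 2 * (fst_coord (R x) * fst_coord y + fst_coord x * fst_coord (R y)) * fst_coord (R (e 1))"
    for x y
    using arg_cong[OF rb[of x y], of fst_coord]
    by (simp add: prd_eq_fst_coord R.add R.scale algebra_simps)
  \<comment> \<open>\<open>2 a\<^sup>2 = 4 a\<^sup>2\<close> for \<open>a = \<phi>(R e\<^sub>1)\<close>.\<close>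
  have "fst_coord (R (e 1)) = 0" using *[of "e 1" "e 1"] by simp
  \<comment> \<open>The right-hand side vanishes because \<open>\<phi>(e\<^sub>2) = 0\<close>.\<close>
  moreover have "fst_coord (R (e 2)) = 0" using *[of "e 2" "e 2"] by simp
  ultimately show "Vector_Spaces.linear smul smul R \<and> (\<forall>x. fst_coord (R x) = 0)"
    using lin fst_coord_comp_zero_iff[OF lin] by simp
next
  assume R: "Vector_Spaces.linear smul smul R \<and> (\<forall>x. fst_coord (R x) = 0)"
  interpret R: Vector_Spaces.linear smul smul R using R by blast
  show "rota_baxter_operator smul prd R"
    using R by (simp add: rota_baxter_operator_def prd_eq_fst_coord R.zero)
qed

text \<open>
  The kernel of \<open>\<phi>\<close> is the line spanned by \<open>e\<^sub>2\<close>, and a first row of zeros puts both \<open>R e\<^sub>1\<close> and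
  \<open>R e\<^sub>2\<close> on this line.
\<close>

lemma has_matrix_iff_fst_coord_zero:
  assumes "Vector_Spaces.linear smul smul R"
  shows "(\<exists>r21 r22. has_matrix smul e R (vector [vector [0, 0], vector [r21, r22]]))
     \<longleftrightarrow> (\<forall>x. fst_coord (R x) = 0)"
proof -
  have mat: "has_matrix smul e R (vector [vector [0, 0], vector [r21, r22]])
      \<longleftrightarrow> R (e 1) = smul r21 (e 2) \<and> R (e 2) = smul r22 (e 2)" for r21 r22
    unfolding has_matrix_def forall_2 sum_2 vector_2 by simp
  have ker: "(\<exists>r. x = smul r (e 2)) \<longleftrightarrow> fst_coord x = 0" for x
  proof
    assume "fst_coord x = 0"
    then have "smul (coords smul e x $ 1) (e 1) + smul (coords smul e x $ 2) (e 2)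
        = smul (coords smul e x $ 2) (e 2)"
      by simp
    then have "x = smul (coords smul e x $ 2) (e 2)"
      by (simp only: sum_two_coords)
    then show "\<exists>r. x = smul r (e 2)" ..
  qed auto
  show ?thesis
    unfolding mat fst_coord_comp_zero_iff[OF assms] by (simp add: ker)
qed

lemma induced_mult_zero:
  assumes "rota_baxter_operator smul prd R"
  shows "induced_mult prd R = (\<lambda>x y. 0)"
  using assms
  by (auto simp: rota_baxter_iff_fst_coord_zero induced_mult_def prd_eq_fst_coord fun_eq_iff)

text \<open>
  With both products zero, multiplicativity of the coordinate map only says that it sends \<open>0\<close>
  to \<open>0\<close>.
\<close>

lemma induced_pre_jordan_isomorphic_zero:
  assumes "rota_baxter_operator smul prd R"
  shows "pre_jordan_isomorphic smul (induced_mult prd R) (*s) (\<lambda>x y. 0 :: complex^2)"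
proof -
  interpret c: Vector_Spaces.linear smul "(*s)" "coords smul e"
    by (rule linear_coords[OF basis])
  show ?thesis
    unfolding pre_jordan_isomorphic_def induced_mult_zero[OF assms]
    using zero_mult_pre_jordan vec.zero_mult_pre_jordan linear_coords[OF basis]
      bij_coords[OF basis] c.zero
    by blast
qed

end

theorem proposition5p7:
  fixes smul :: "complex \<Rightarrow> 'a::ab_group_add \<Rightarrow> 'a"
    and circ :: "'a \<Rightarrow> 'a \<Rightarrow> 'a"
    and e :: "2 \<Rightarrow> 'a"
  assumes "J3_algebra smul circ e"
  shows "(\<forall>R. rota_baxter_operator smul circ R \<longleftrightarrow>
            Vector_Spaces.linear smul smul R \<and>
            (\<exists>r21 r22 :: complex.
               has_matrix smul e R (vector [vector [0, 0], vector [r21, r22]]))) \<and>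
         (\<forall>R. rota_baxter_operator smul circ R \<longrightarrow>
            pre_jordan_isomorphic smul (induced_mult circ R)
              (*s) (\<lambda>x y. 0 :: complex^2))"
proof -
  interpret J3_algebra smul circ e by (rule assms)
  show ?thesis
    using rota_baxter_iff_fst_coord_zero has_matrix_iff_fst_coord_zero
      induced_pre_jordan_isomorphic_zero
    by blast
qed

end
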